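(* Let $(X,\mathbb{F})$ and $(Y,\mathbb{G})$ be non-autonomous dynamical systems generated by $\mathbb{F}=\{f_n:n\in\mathbb{N}\}$ and $\mathbb{G}=\{g_n:n\in\mathbb{N}\}$ respectively. If $(g_n)$ converges uniformly to a map $g$, then for all $x_1,x_2\in X$ and $y_1,y_2\in Y$: $((x_1,x_2),(y_1,y_2))\in M(X,\mathbb{F})\times M(Y,\mathbb{G})$ if and only if $((x_1,y_1),(x_2,y_2))\in M(X\times Y,\mathbb{F}\times\mathbb{G})$.
   Context: A non-autonomous system $(X,\mathbb{F})$ consists of a compact metric space $(X,d_X)$ and a sequence $\mathbb{F}=(f_n)_{n\ge 1}$ of surjective continuous self-maps of $X$; $\omega_n=f_n\circ\cdots\circ f_1$. The product system $(X\times Y,\mathbb{F}\times\mathbb{G})$ is generated by the maps $f_n\times g_n$ on $X\times Y$ with the product (e.g. maximum) metric. A set $S=\{s_n:n\in\mathbb{N}\}\subseteq\mathbb{N}$ (with $s_1<s_2<\cdots$) is syndetic if there is $M\in\mathbb{N}$ with $|s_{n+1}-s_n|\le M$ for all $n$. For any non-autonomous system $(X,\mathbb{F})$, $M(X,\mathbb{F})$ is the set of regionally syndetically proximal pairs, i.e. pairs $(x,y)\in X\times X$ such that for every $\epsilon>0$ and all neighborhoods $U$ of $x$ and $V$ of $y$ there are $z_1\in U$, $z_2\in V$ such that $\{n\in\mathbb{N}: d_X(\omega_n(z_1),\omega_n(z_2))<\epsilon\}$ is syndetic. *)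

theory Defs
  imports "HOL-Analysis.Analysis"
begin

text \<open>
  A sequence indexed by the positive integers is a function on \<^typ>\<open>nat\<close> whose value at
  \<open>0\<close> is never constrained or used.
\<close>

locale nonautonomous_system = Metric_space X d
  for X :: "'a set" and d :: "'a \<Rightarrow> 'a \<Rightarrow> real" +
  fixes f :: "nat \<Rightarrow> 'a \<Rightarrow> 'a"
  assumes compact: "compact_space mtopology"
    and continuous: "\<And>n. n \<ge> 1 \<Longrightarrow> continuous_map mtopology mtopology (f n)"
    and surjective: "\<And>n. n \<ge> 1 \<Longrightarrow> f n ` X = X"

primrec \<omega> :: "(nat \<Rightarrow> 'a \<Rightarrow> 'a) \<Rightarrow> nat \<Rightarrow> 'a \<Rightarrow> 'a" where
  "\<omega> f 0 = id"
| "\<omega> f (Suc n) = f (Suc n) \<circ> \<omega> f n"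

definition syndetic :: "nat set \<Rightarrow> bool" where
  "syndetic S \<longleftrightarrow>
     (\<exists>s. strict_mono s \<and> S = range s \<and> (\<exists>M. \<forall>n. s (Suc n) - s n \<le> M))"

text \<open>Neighborhoods need not be open.\<close>

definition neighborhood :: "'a topology \<Rightarrow> 'a \<Rightarrow> 'a set \<Rightarrow> bool" where
  "neighborhood T x U \<longleftrightarrow> U \<subseteq> topspace T \<and> (\<exists>W. openin T W \<and> x \<in> W \<and> W \<subseteq> U)"

definition reg_synd_prox ::
  "'a set \<Rightarrow> ('a \<Rightarrow> 'a \<Rightarrow> real) \<Rightarrow> (nat \<Rightarrow> 'a \<Rightarrow> 'a) \<Rightarrow> ('a \<times> 'a) set" where
  "reg_synd_prox X d f =
     {(x, y). x \<in> X \<and> y \<in> X \<and>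
        (\<forall>\<epsilon>>0. \<forall>U V. neighborhood (Metric_space.mtopology X d) x U \<longrightarrow>
                      neighborhood (Metric_space.mtopology X d) y V \<longrightarrow>
           (\<exists>z\<^sub>1\<in>U. \<exists>z\<^sub>2\<in>V. syndetic {n. n \<ge> 1 \<and> d (\<omega> f n z\<^sub>1) (\<omega> f n z\<^sub>2) < \<epsilon>}))}"

definition converges_uniformly ::
  "'a set \<Rightarrow> ('a \<Rightarrow> 'a \<Rightarrow> real) \<Rightarrow> (nat \<Rightarrow> 'a \<Rightarrow> 'a) \<Rightarrow> ('a \<Rightarrow> 'a) \<Rightarrow> bool" where
  "converges_uniformly Y d g h \<longleftrightarrow>
     (\<forall>\<epsilon>>0. \<forall>\<^sub>F n in sequentially. \<forall>y\<in>Y. d (g n y) (h y) < \<epsilon>)"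

text \<open>
  The maximum metric, rather than the library's Euclidean \<^const>\<open>prod_dist\<close>. It induces the
  product topology, see \<open>mtopology_max_dist\<close> below.
\<close>

definition max_dist ::
  "('a \<Rightarrow> 'a \<Rightarrow> real) \<Rightarrow> ('b \<Rightarrow> 'b \<Rightarrow> real) \<Rightarrow> 'a \<times> 'b \<Rightarrow> 'a \<times> 'b \<Rightarrow> real" where
  "max_dist d e = (\<lambda>(x, y) (x', y'). max (d x x') (e y y'))"

definition product_maps ::
  "(nat \<Rightarrow> 'a \<Rightarrow> 'a) \<Rightarrow> (nat \<Rightarrow> 'b \<Rightarrow> 'b) \<Rightarrow> nat \<Rightarrow> 'a \<times> 'b \<Rightarrow> 'a \<times> 'b" where
  "product_maps f g n = (\<lambda>(x, y). (f n x, g n y))"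

lemma Metric_space_max_dist:
  assumes "Metric_space X d" "Metric_space Y e"
  shows "Metric_space (X \<times> Y) (max_dist d e)"
proof -
  interpret A: Metric_space X d by fact
  interpret B: Metric_space Y e by fact
  show ?thesis
  proof (unfold_locales, goal_cases)
    case (1 p q) then show ?case
      by (auto simp: max_dist_def le_max_iff_disj split: prod.splits)
  next
    case (2 p q) then show ?case
      by (auto simp: max_dist_def A.commute B.commute split: prod.splits)
  next
    case (3 p q)
    have "max (a::real) b = 0 \<longleftrightarrow> a = 0 \<and> b = 0" if "a \<ge> 0" "b \<ge> 0" for a b
      using that by auto
    with 3 show ?case
      by (auto simp: max_dist_def split: prod.splits)
  next
    case (4 p q r)
    obtain a b where p: "p = (a, b)" by force
    obtain a' b' where q: "q = (a', b')" by force
    obtain a'' b'' where r: "r = (a'', b'')" by force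
    have "d a a'' \<le> d a a' + d a' a''" "e b b'' \<le> e b b' + e b' b''"
      using 4 A.triangle B.triangle by (auto simp: p q r)
    then show ?case
      unfolding p q r max_dist_def prod.case by linarith
  qed
qed

lemma mtopology_max_dist:
  assumes "Metric_space X d" "Metric_space Y e"
  shows "Metric_space.mtopology (X \<times> Y) (max_dist d e) =
         prod_topology (Metric_space.mtopology X d) (Metric_space.mtopology Y e)"
proof -
  interpret A: Metric_space X d by fact
  interpret B: Metric_space Y e by fact
  interpret P: Metric_space "X \<times> Y" "max_dist d e"
    by (intro Metric_space_max_dist assms)
  have ball: "P.mball (x, y) r = A.mball x r \<times> B.mball y r" for x y r
    unfolding P.mball_def A.mball_def B.mball_def by (auto simp: max_dist_def)
  show ?thesis
  proof (rule topology_eq[THEN iffD2], intro allI iffI)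
    fix S assume S: "openin P.mtopology S"
    show "openin (prod_topology A.mtopology B.mtopology) S"
      unfolding openin_prod_topology_alt
    proof (intro allI impI)
      fix x y assume xy: "(x, y) \<in> S"
      then obtain r where "r > 0" "P.mball (x, y) r \<subseteq> S"
        using S unfolding P.openin_mtopology by blast
      moreover have "x \<in> X" "y \<in> Y"
        using S xy by (auto simp: P.openin_mtopology)
      ultimately show "\<exists>U V. openin A.mtopology U \<and> openin B.mtopology V \<and>
          x \<in> U \<and> y \<in> V \<and> U \<times> V \<subseteq> S"
        unfolding ball
        by (intro exI[of _ "A.mball x r"] exI[of _ "B.mball y r"] conjI) simp_all
    qed
  next
    fix S assume S: "openin (prod_topology A.mtopology B.mtopology) S"
    have "\<exists>r>0. P.mball p r \<subseteq> S" if p: "p \<in> S" for p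
    proof -
      obtain x y where pxy: "p = (x, y)" by force
      obtain U V where UV: "openin A.mtopology U" "openin B.mtopology V"
          "x \<in> U" "y \<in> V" "U \<times> V \<subseteq> S"
        using S[unfolded openin_prod_topology_alt, rule_format, of x y] p pxy by blast
      obtain r where r: "r > 0" "A.mball x r \<subseteq> U"
        using UV(1,3) by (auto simp: A.openin_mtopology)
      obtain s where s: "s > 0" "B.mball y s \<subseteq> V"
        using UV(2,4) by (auto simp: B.openin_mtopology)
      have "P.mball p (min r s) \<subseteq> A.mball x r \<times> B.mball y s"
        unfolding pxy ball by auto
      also have "\<dots> \<subseteq> U \<times> V" using r s by (intro Sigma_mono)
      also note \<open>U \<times> V \<subseteq> S\<close>
      finally show ?thesis using r s by (intro exI[of _ "min r s"]) simp
    qed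
    moreover have "S \<subseteq> X \<times> Y"
      using openin_subset[OF S] by simp
    ultimately show "openin P.mtopology S"
      unfolding P.openin_mtopology by blast
  qed
qed

lemma nonautonomous_system_product:
  assumes "nonautonomous_system X d f" "nonautonomous_system Y e g"
  shows "nonautonomous_system (X \<times> Y) (max_dist d e) (product_maps f g)"
proof -
  interpret A: nonautonomous_system X d f by fact
  interpret B: nonautonomous_system Y e g by fact
  interpret P: Metric_space "X \<times> Y" "max_dist d e"
    by (intro Metric_space_max_dist A.Metric_space_axioms B.Metric_space_axioms)
  have top: "P.mtopology = prod_topology A.mtopology B.mtopology"
    by (intro mtopology_max_dist A.Metric_space_axioms B.Metric_space_axioms)
  show ?thesis
  proof (unfold_locales, goal_cases)
    case 1 show ?case
      unfolding top by (simp add: compact_space_prod_topology A.compact B.compact)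
  next
    case (2 n) then show ?case
      unfolding top product_maps_def
      by (simp add: continuous_map_prod_top A.continuous B.continuous)
  next
    case (3 n)
    have "product_maps f g n ` (X \<times> Y) = (f n ` X) \<times> (g n ` Y)"
      unfolding product_maps_def by (rule image_paired_Times)
    with 3 show ?case by (simp add: A.surjective B.surjective)
  qed
qed

end

theory Submission
  imports Defs
begin

text \<open>
  Projections do not increase the maximum metric, which gives the backward implication.
  For the forward implication, first pick points of \<open>X\<close> whose orbits are \<open>\<epsilon>\<close>-close at the times
  of a syndetic set \<open>A\<close>, with gaps at most \<open>M\<close>. Since \<open>(g\<^sub>n)\<close> converges uniformly it is
  uniformly equicontinuous, so there is \<open>\<delta>\<close> such that any two orbits in \<open>Y\<close> that are
  \<open>\<delta>\<close>-close at some time stay \<open>\<epsilon>\<close>-close for the next \<open>M\<close> steps. Now pick the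
  points of \<open>Y\<close> for this \<open>\<delta>\<close>: each time at which they are \<open>\<delta>\<close>-close is followed within \<open>M\<close>
  steps by an element of \<open>A\<close>, at which both pairs are \<open>\<epsilon>\<close>-close.
\<close>

section \<open>Syndetic sets\<close>

text \<open>Frees later arguments from enumerations: with windows of a fixed length, passing to a
  superset is immediate and two bounds can simply be added.\<close>

lemma syndetic_iff_meets_intervals:
  "syndetic S \<longleftrightarrow> (\<exists>M. \<forall>n. \<exists>m\<in>S. n \<le> m \<and> m \<le> n + M)"
proof
  assume "syndetic S"
  then obtain s M where s: "strict_mono s" "S = range s"
    and M: "\<And>n. s (Suc n) - s n \<le> M"
    unfolding syndetic_def by blast
  \<comment> \<open>The definition bounds only gaps between consecutive elements, so
    \<open>s 0\<close> accounts for the stretch before the first one. A witness for \<open>n\<close>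
    still serves for \<open>Suc n\<close> unless it is \<open>n\<close> itself; then the next
    element does.\<close>
  have "\<exists>m\<in>S. n \<le> m \<and> m \<le> n + (M + s 0)" for n
  proof (induction n)
    case 0
    show ?case using s(2) by (intro bexI[of _ "s 0"]) auto
  next
    case (Suc n)
    then obtain k where k: "n \<le> s k" "s k \<le> n + (M + s 0)"
      using s(2) by auto
    show ?case
    proof (cases "s k = n")
      case True
      have "n < s (Suc k)"
        using True s(1) strict_monoD by blast
      moreover have "s (Suc k) \<le> n + M"
        using M[of k] True by linarith
      ultimately show ?thesis
        using s(2) by (intro bexI[of _ "s (Suc k)"]) auto
    next
      case False
      then show ?thesis
        using k s(2) by (intro bexI[of _ "s k"]) auto
    qed
  qed
  then show "\<exists>M. \<forall>n. \<exists>m\<in>S. n \<le> m \<and> m \<le> n + M"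
    by blast
next
  assume "\<exists>M. \<forall>n. \<exists>m\<in>S. n \<le> m \<and> m \<le> n + M"
  then obtain M where M: "\<And>n. \<exists>m\<in>S. n \<le> m \<and> m \<le> n + M"
    by blast
  have inf: "infinite S"
    unfolding infinite_nat_iff_unbounded_le using M by blast
  \<comment> \<open>The window is started one past \<open>enumerate S n\<close> to exclude that
    element itself, hence \<open>Suc M\<close>.\<close>
  have "enumerate S (Suc n) - enumerate S n \<le> Suc M" for n
  proof -
    obtain m where m: "m \<in> S" "Suc (enumerate S n) \<le> m" "m \<le> Suc (enumerate S n) + M"
      using M by blast
    have "enumerate S (Suc n) \<le> m"
      unfolding enumerate_Suc''[OF inf] using m by (intro Least_le) auto
    then show ?thesis using m by linarith
  qed
  then show "syndetic S"
    unfolding syndetic_def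
    using strict_mono_enumerate[OF inf] range_enumerate[OF inf]
    by (intro exI[of _ "enumerate S"]) auto
qed

lemma syndetic_mono:
  assumes "syndetic S" "S \<subseteq> T"
  shows "syndetic T"
proof -
  obtain M where "\<And>n. \<exists>m\<in>S. n \<le> m \<and> m \<le> n + M"
    using assms(1) unfolding syndetic_iff_meets_intervals by blast
  with assms(2) have "\<exists>m\<in>T. n \<le> m \<and> m \<le> n + M" for n
    by (meson subsetD)
  then show ?thesis
    unfolding syndetic_iff_meets_intervals by blast
qed

section \<open>Orbits and neighborhoods\<close>

lemma \<omega>_in_space:
  assumes "nonautonomous_system X d f" "x \<in> X"
  shows "\<omega> f n x \<in> X"
proof -
  interpret nonautonomous_system X d f by fact
  show ?thesis
    using assms(2) surjective by (induction n) force+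
qed

lemma \<omega>_product_maps:
  "\<omega> (product_maps f g) n (x, y) = (\<omega> f n x, \<omega> g n y)"
  by (induction n) (simp_all add: product_maps_def)

lemma product_neighborhoodE:
  assumes "neighborhood (prod_topology T T') (x, y) W"
  obtains U V where "neighborhood T x U" "neighborhood T' y V" "U \<times> V \<subseteq> W"
proof -
  obtain W' where W': "openin (prod_topology T T') W'" "(x, y) \<in> W'" "W' \<subseteq> W"
    using assms unfolding neighborhood_def by blast
  then obtain U V where "openin T U" "openin T' V" "x \<in> U" "y \<in> V" "U \<times> V \<subseteq> W'"
    using openin_prod_topology_alt[THEN iffD1, rule_format] by metis
  moreover from this have "neighborhood T x U" "neighborhood T' y V"
    unfolding neighborhood_def by (meson openin_subset order_refl)+
  ultimately show thesis
    using that W'(3) by (meson order_trans)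
qed

lemma neighborhood_vimage:
  assumes "continuous_map T T' \<pi>" "neighborhood T' (\<pi> x) U" "x \<in> topspace T"
  shows "neighborhood T x {z \<in> topspace T. \<pi> z \<in> U}"
proof -
  obtain W where W: "openin T' W" "\<pi> x \<in> W" "W \<subseteq> U"
    using assms(2) unfolding neighborhood_def by blast
  have "openin T {z \<in> topspace T. \<pi> z \<in> W}"
    using assms(1) W(1) by (rule openin_continuous_map_preimage)
  with W(2,3) assms(3) show ?thesis
    unfolding neighborhood_def by blast
qed

section \<open>Nonexpansive factor maps\<close>

text \<open>Treats both projections at once. Points found in the preimages of \<open>U\<close> and
  \<open>V\<close> are pushed forward by \<open>\<pi>\<close>; their images are close whenever they
  are, and a superset of a syndetic set is syndetic.\<close>

lemma reg_synd_prox_factor: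
  assumes "Metric_space P D" "Metric_space X d"
    and cont: "continuous_map (Metric_space.mtopology P D) (Metric_space.mtopology X d) \<pi>"
    and nonexpansive: "\<And>p q. d (\<pi> p) (\<pi> q) \<le> D p q"
    and semiconj: "\<And>n p. \<pi> (\<omega> F n p) = \<omega> f n (\<pi> p)"
    and pq: "(p, q) \<in> reg_synd_prox P D F"
  shows "(\<pi> p, \<pi> q) \<in> reg_synd_prox X d f"
proof -
  interpret P: Metric_space P D by fact
  interpret X: Metric_space X d by fact
  have mem: "p \<in> P" "q \<in> P"
    using pq by (auto simp: reg_synd_prox_def)
  have "\<pi> p \<in> X" "\<pi> q \<in> X"
    using cont mem by (auto simp: continuous_map_def)
  moreover have "\<exists>u\<in>U. \<exists>v\<in>V. syndetic {n. n \<ge> 1 \<and> d (\<omega> f n u) (\<omega> f n v) < \<epsilon>}"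
    if "\<epsilon> > 0" and U: "neighborhood X.mtopology (\<pi> p) U"
      and V: "neighborhood X.mtopology (\<pi> q) V" for \<epsilon> U V
  proof -
    obtain u v where uv: "\<pi> u \<in> U" "\<pi> v \<in> V"
      and synd: "syndetic {n. n \<ge> 1 \<and> D (\<omega> F n u) (\<omega> F n v) < \<epsilon>}"
      using pq \<open>\<epsilon> > 0\<close> neighborhood_vimage[OF cont U] neighborhood_vimage[OF cont V] mem
      unfolding reg_synd_prox_def by fastforce
    have "syndetic {n. n \<ge> 1 \<and> d (\<omega> f n (\<pi> u)) (\<omega> f n (\<pi> v)) < \<epsilon>}"
      using synd
    proof (rule syndetic_mono)
      show "{n. n \<ge> 1 \<and> D (\<omega> F n u) (\<omega> F n v) < \<epsilon>} \<subseteq>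
        {n. n \<ge> 1 \<and> d (\<omega> f n (\<pi> u)) (\<omega> f n (\<pi> v)) < \<epsilon>}"
        using nonexpansive le_less_trans by (fastforce simp flip: semiconj)
    qed
    with uv show ?thesis by blast
  qed
  ultimately show ?thesis
    unfolding reg_synd_prox_def by blast
qed

section \<open>Equicontinuity of the generators\<close>

text \<open>Heine-Cantor on the compact space \<open>Y\<close>, transferred from bundled metrics
  \<open>metric (Y, e)\<close> to the locale.\<close>

lemma uniformly_continuous_generator:
  assumes "nonautonomous_system Y e g" "n \<ge> 1" "\<epsilon> > 0"
  shows "\<exists>\<delta>>0. \<forall>x\<in>Y. \<forall>y\<in>Y. e x y < \<delta> \<longrightarrow> e (g n x) (g n y) < \<epsilon>"
proof -
  interpret nonautonomous_system Y e g by fact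
  have top: "mtopology_of (metric (Y, e)) = mtopology"
    by (simp add: mtopology_of_def)
  have "uniformly_continuous_map (metric (Y, e)) (metric (Y, e)) (g n)"
    using continuous_eq_uniformly_continuous_map[of "metric (Y, e)" "metric (Y, e)" "g n"]
      compact continuous[OF assms(2)] by (simp add: top)
  then show ?thesis
    using assms(3) unfolding uniformly_continuous_map_def mspace_metric mdist_metric
    by (metis commute)
qed

text \<open>The maps up to \<open>N'\<close> are handled one by one, with the least of finitely many
  moduli. A later \<open>g n\<close> is within \<open>2 * \<epsilon> / 5\<close> of
  \<open>g N'\<close> by way of \<open>h\<close>, so it inherits the modulus of
  \<open>g N'\<close>.\<close>

lemma uniformly_equicontinuous_generators:
  assumes sys: "nonautonomous_system Y e g" and h: "h \<in> Y \<rightarrow> Y"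
    and lim: "converges_uniformly Y e g h" and "\<epsilon> > 0"
  shows "\<exists>\<delta>>0. \<forall>n\<ge>1. \<forall>x\<in>Y. \<forall>y\<in>Y. e x y < \<delta> \<longrightarrow> e (g n x) (g n y) < \<epsilon>"
proof -
  interpret nonautonomous_system Y e g by fact
  obtain N where N: "\<And>n y. n \<ge> N \<Longrightarrow> y \<in> Y \<Longrightarrow> e (g n y) (h y) < \<epsilon> / 5"
    using lim \<open>\<epsilon> > 0\<close> unfolding converges_uniformly_def eventually_sequentially
    by (metis zero_less_divide_iff zero_less_numeral)
  \<comment> \<open>Index 0 is unconstrained, so the reference map must have index at least 1; this
    also makes the range of the minimum nonempty.\<close>
  define N' where "N' = max N 1"
  have "\<forall>n\<in>{1..N'}. \<exists>\<delta>>0. \<forall>x\<in>Y. \<forall>y\<in>Y. e x y < \<delta> \<longrightarrow> e (g n x) (g n y) < \<epsilon> / 5"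
    using uniformly_continuous_generator[OF sys, of _ "\<epsilon> / 5"] \<open>\<epsilon> > 0\<close> by simp
  then obtain \<delta> where \<delta>: "\<And>n. n \<in> {1..N'} \<Longrightarrow> \<delta> n > 0"
    "\<And>n x y. n \<in> {1..N'} \<Longrightarrow> x \<in> Y \<Longrightarrow> y \<in> Y \<Longrightarrow> e x y < \<delta> n \<Longrightarrow> e (g n x) (g n y) < \<epsilon> / 5"
    by metis
  define \<delta>' where "\<delta>' = Min (\<delta> ` {1..N'})"
  have "\<delta>' > 0"
    unfolding \<delta>'_def using \<delta>(1) by (subst Min_gr_iff) (auto simp: N'_def)
  have \<delta>': "e (g n x) (g n y) < \<epsilon> / 5"
    if "n \<in> {1..N'}" "x \<in> Y" "y \<in> Y" "e x y < \<delta>'" for n x y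
  proof -
    have "\<delta>' \<le> \<delta> n"
      unfolding \<delta>'_def using that(1) by (intro Min_le) auto
    with that \<delta>(2) show ?thesis by force
  qed
  have "e (g n x) (g n y) < \<epsilon>" if "n \<ge> 1" "x \<in> Y" "y \<in> Y" "e x y < \<delta>'" for n x y
  proof (cases "n \<le> N'")
    case True
    then show ?thesis using \<delta>'[of n x y] that \<open>\<epsilon> > 0\<close> by simp
  next
    case False
    have mem: "g n x \<in> Y" "g n y \<in> Y" "h x \<in> Y" "h y \<in> Y" "g N' x \<in> Y" "g N' y \<in> Y"
      using surjective[of n] surjective[of N'] that h by (auto simp: N'_def)
    have "e (g n x) (h x) < \<epsilon> / 5" "e (g n y) (h y) < \<epsilon> / 5"
      "e (g N' x) (h x) < \<epsilon> / 5" "e (g N' y) (h y) < \<epsilon> / 5"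
      using N that False by (auto simp: N'_def)
    moreover have "e (g N' x) (g N' y) < \<epsilon> / 5"
      using \<delta>'[of N'] that by (simp add: N'_def)
    \<comment> \<open>The chain \<open>g n x\<close>, \<open>h x\<close>, \<open>g N' x\<close>,
      \<open>g N' y\<close>, \<open>h y\<close>, \<open>g n y\<close> has five links, each shorter
      than \<open>\<epsilon> / 5\<close>.\<close>
    moreover have "e (g n x) (g n y) \<le> e (g n x) (h x) + e (h x) (g n y)"
      "e (h x) (g n y) \<le> e (h x) (g N' x) + e (g N' x) (g n y)"
      "e (g N' x) (g n y) \<le> e (g N' x) (g N' y) + e (g N' y) (g n y)"
      "e (g N' y) (g n y) \<le> e (g N' y) (h y) + e (h y) (g n y)"
      using mem by (auto intro!: triangle)
    ultimately show ?thesis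
      by (simp add: commute)
  qed
  with \<open>\<delta>' > 0\<close> show ?thesis by blast
qed

text \<open>Induction on \<open>M\<close> puts one application of a generator in front of the
  remaining \<open>M\<close> steps. Since the modulus in \<open>equi\<close> is common to all
  generators, \<open>\<delta>\<close> does not depend on the starting time \<open>n\<close>.\<close>

lemma orbits_stay_close:
  assumes sys: "nonautonomous_system Y e g"
    and equi: "\<And>\<epsilon>. \<epsilon> > 0 \<Longrightarrow>
      \<exists>\<delta>>0. \<forall>n\<ge>1. \<forall>x\<in>Y. \<forall>y\<in>Y. e x y < \<delta> \<longrightarrow> e (g n x) (g n y) < \<epsilon>"
    and "\<epsilon> > 0"
  shows "\<exists>\<delta>>0. \<forall>n. \<forall>x\<in>Y. \<forall>y\<in>Y. e (\<omega> g n x) (\<omega> g n y) < \<delta> \<longrightarrow>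
    (\<forall>k\<le>M. e (\<omega> g (n + k) x) (\<omega> g (n + k) y) < \<epsilon>)"
proof (induction M)
  case 0
  show ?case using \<open>\<epsilon> > 0\<close> by auto
next
  case (Suc M)
  then obtain \<delta> where "\<delta> > 0" and \<delta>: "\<And>n x y k. x \<in> Y \<Longrightarrow> y \<in> Y \<Longrightarrow>
      e (\<omega> g n x) (\<omega> g n y) < \<delta> \<Longrightarrow> k \<le> M \<Longrightarrow> e (\<omega> g (n + k) x) (\<omega> g (n + k) y) < \<epsilon>"
    by blast
  obtain \<delta>' where "\<delta>' > 0" and \<delta>': "\<And>n x y. n \<ge> 1 \<Longrightarrow> x \<in> Y \<Longrightarrow> y \<in> Y \<Longrightarrow>
      e x y < \<delta>' \<Longrightarrow> e (g n x) (g n y) < \<delta>"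
    using equi[OF \<open>\<delta> > 0\<close>] by blast
  \<comment> \<open>In the minimum, \<open>\<epsilon>\<close> settles \<open>k = 0\<close>, and
    \<open>\<delta>'\<close> ensures \<open>\<delta>\<close>-closeness at time \<open>Suc n\<close>,
    from which at most \<open>M\<close> steps remain.\<close>
  have "e (\<omega> g (n + k) x) (\<omega> g (n + k) y) < \<epsilon>"
    if xy: "x \<in> Y" "y \<in> Y" and close: "e (\<omega> g n x) (\<omega> g n y) < min \<epsilon> \<delta>'" and "k \<le> Suc M"
    for n x y k
  proof (cases k)
    case 0
    then show ?thesis using close by simp
  next
    case (Suc j)
    have "e (\<omega> g (Suc n) x) (\<omega> g (Suc n) y) < \<delta>"
      using \<delta>'[of "Suc n"] xy close by (simp add: \<omega>_in_space[OF sys])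
    from \<delta>[OF xy this, of j] show ?thesis
      using Suc \<open>k \<le> Suc M\<close> by simp
  qed
  with \<open>\<epsilon> > 0\<close> \<open>\<delta>' > 0\<close> show ?case
    by (intro exI[of _ "min \<epsilon> \<delta>'"]) auto
qed

section \<open>Pairs in the product system\<close>

text \<open>Uniform convergence enters only through equicontinuity, which is therefore the
  hypothesis \<open>equi\<close>.\<close>

lemma reg_synd_prox_product:
  assumes sysX: "nonautonomous_system X d f" and sysY: "nonautonomous_system Y e g"
    and equi: "\<And>\<epsilon>. \<epsilon> > 0 \<Longrightarrow>
      \<exists>\<delta>>0. \<forall>n\<ge>1. \<forall>x\<in>Y. \<forall>y\<in>Y. e x y < \<delta> \<longrightarrow> e (g n x) (g n y) < \<epsilon>"
    and x: "(x\<^sub>1, x\<^sub>2) \<in> reg_synd_prox X d f"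
    and y: "(y\<^sub>1, y\<^sub>2) \<in> reg_synd_prox Y e g"
  shows "((x\<^sub>1, y\<^sub>1), (x\<^sub>2, y\<^sub>2)) \<in> reg_synd_prox (X \<times> Y) (max_dist d e) (product_maps f g)"
proof -
  interpret X: nonautonomous_system X d f by fact
  interpret Y: nonautonomous_system Y e g by fact
  interpret P: Metric_space "X \<times> Y" "max_dist d e"
    by (intro Metric_space_max_dist X.Metric_space_axioms Y.Metric_space_axioms)
  have top: "P.mtopology = prod_topology X.mtopology Y.mtopology"
    by (intro mtopology_max_dist X.Metric_space_axioms Y.Metric_space_axioms)
  have "\<exists>u\<in>U. \<exists>v\<in>V. syndetic
      {n. n \<ge> 1 \<and> max_dist d e (\<omega> (product_maps f g) n u) (\<omega> (product_maps f g) n v) < \<epsilon>}"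
    if "\<epsilon> > 0" and U: "neighborhood P.mtopology (x\<^sub>1, y\<^sub>1) U"
      and V: "neighborhood P.mtopology (x\<^sub>2, y\<^sub>2) V" for \<epsilon> U V
  proof -
    obtain U\<^sub>X U\<^sub>Y where U': "neighborhood X.mtopology x\<^sub>1 U\<^sub>X" "neighborhood Y.mtopology y\<^sub>1 U\<^sub>Y"
        "U\<^sub>X \<times> U\<^sub>Y \<subseteq> U"
      using U unfolding top by (rule product_neighborhoodE)
    obtain V\<^sub>X V\<^sub>Y where V': "neighborhood X.mtopology x\<^sub>2 V\<^sub>X" "neighborhood Y.mtopology y\<^sub>2 V\<^sub>Y"
        "V\<^sub>X \<times> V\<^sub>Y \<subseteq> V"
      using V unfolding top by (rule product_neighborhoodE)
    obtain u v where uv: "u \<in> U\<^sub>X" "v \<in> V\<^sub>X"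
      and "syndetic {n. n \<ge> 1 \<and> d (\<omega> f n u) (\<omega> f n v) < \<epsilon>}"
      using x \<open>\<epsilon> > 0\<close> U'(1) V'(1) unfolding reg_synd_prox_def by blast
    then obtain M where
      M: "\<And>n. \<exists>m\<ge>n. m \<le> n + M \<and> m \<ge> 1 \<and> d (\<omega> f m u) (\<omega> f m v) < \<epsilon>"
      unfolding syndetic_iff_meets_intervals by blast
    obtain \<delta> where "\<delta> > 0" and \<delta>: "\<And>n x y k. x \<in> Y \<Longrightarrow> y \<in> Y \<Longrightarrow>
        e (\<omega> g n x) (\<omega> g n y) < \<delta> \<Longrightarrow> k \<le> M \<Longrightarrow> e (\<omega> g (n + k) x) (\<omega> g (n + k) y) < \<epsilon>"
      using orbits_stay_close[OF sysY equi \<open>\<epsilon> > 0\<close>, of M] by blast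
    obtain u' v' where uv': "u' \<in> U\<^sub>Y" "v' \<in> V\<^sub>Y"
      and "syndetic {n. n \<ge> 1 \<and> e (\<omega> g n u') (\<omega> g n v') < \<delta>}"
      using y \<open>\<delta> > 0\<close> U'(2) V'(2) unfolding reg_synd_prox_def by blast
    then obtain L where
      L: "\<And>n. \<exists>m\<ge>n. m \<le> n + L \<and> e (\<omega> g m u') (\<omega> g m v') < \<delta>"
      unfolding syndetic_iff_meets_intervals by blast
    have mem: "u' \<in> Y" "v' \<in> Y"
      using uv' U'(2) V'(2) by (auto simp: neighborhood_def)
    \<comment> \<open>At most \<open>L\<close> steps lead from \<open>n\<close> to a time
      \<open>l\<close> of \<open>\<delta>\<close>-closeness in \<open>Y\<close>, and at most
      \<open>M\<close> more to a time \<open>m\<close> of closeness in \<open>X\<close>;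
      \<open>\<delta>\<close> covers the delay \<open>m - l\<close>.\<close>
    have "\<exists>m. (m \<ge> 1 \<and> d (\<omega> f m u) (\<omega> f m v) < \<epsilon> \<and> e (\<omega> g m u') (\<omega> g m v') < \<epsilon>) \<and>
        n \<le> m \<and> m \<le> n + (L + M)" for n
    proof -
      obtain l where l: "n \<le> l" "l \<le> n + L" "e (\<omega> g l u') (\<omega> g l v') < \<delta>"
        using L by blast
      obtain m where m: "l \<le> m" "m \<le> l + M" "m \<ge> 1" "d (\<omega> f m u) (\<omega> f m v) < \<epsilon>"
        using M by blast
      have "e (\<omega> g m u') (\<omega> g m v') < \<epsilon>"
        using \<delta>[OF mem l(3), of "m - l"] m(1,2) by simp
      with l m show ?thesis
        by (intro exI[of _ m]) simp
    qed
    then have "syndetic {n. n \<ge> 1 \<and> max_dist d e (\<omega> (product_maps f g) n (u, u'))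
        (\<omega> (product_maps f g) n (v, v')) < \<epsilon>}"
      unfolding syndetic_iff_meets_intervals
      by (intro exI[of _ "L + M"]) (simp add: \<omega>_product_maps max_dist_def Bex_def)
    with uv uv' U'(3) V'(3) show ?thesis by blast
  qed
  with x y show ?thesis
    unfolding reg_synd_prox_def by auto
qed

theorem corollary4p2:
  fixes X :: "'a set" and d\<^sub>X :: "'a \<Rightarrow> 'a \<Rightarrow> real" and f :: "nat \<Rightarrow> 'a \<Rightarrow> 'a"
    and Y :: "'b set" and d\<^sub>Y :: "'b \<Rightarrow> 'b \<Rightarrow> real" and g :: "nat \<Rightarrow> 'b \<Rightarrow> 'b"
    and h :: "'b \<Rightarrow> 'b"
  assumes "nonautonomous_system X d\<^sub>X f"
    and "nonautonomous_system Y d\<^sub>Y g"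
    and "h \<in> Y \<rightarrow> Y"
    and "converges_uniformly Y d\<^sub>Y g h"
  shows "\<forall>x\<^sub>1\<in>X. \<forall>x\<^sub>2\<in>X. \<forall>y\<^sub>1\<in>Y. \<forall>y\<^sub>2\<in>Y.
    ((x\<^sub>1, x\<^sub>2), (y\<^sub>1, y\<^sub>2)) \<in> reg_synd_prox X d\<^sub>X f \<times> reg_synd_prox Y d\<^sub>Y g \<longleftrightarrow>
    ((x\<^sub>1, y\<^sub>1), (x\<^sub>2, y\<^sub>2)) \<in> reg_synd_prox (X \<times> Y) (max_dist d\<^sub>X d\<^sub>Y) (product_maps f g)"
proof (intro ballI iffI)
  interpret X: nonautonomous_system X d\<^sub>X f by fact
  interpret Y: nonautonomous_system Y d\<^sub>Y g by fact
  interpret P: Metric_space "X \<times> Y" "max_dist d\<^sub>X d\<^sub>Y"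
    by (intro Metric_space_max_dist X.Metric_space_axioms Y.Metric_space_axioms)
  have top: "P.mtopology = prod_topology X.mtopology Y.mtopology"
    by (intro mtopology_max_dist X.Metric_space_axioms Y.Metric_space_axioms)
  have fst_cont: "continuous_map P.mtopology X.mtopology fst"
    and snd_cont: "continuous_map P.mtopology Y.mtopology snd"
    unfolding top by (rule continuous_map_fst continuous_map_snd)+
  fix x\<^sub>1 x\<^sub>2 y\<^sub>1 y\<^sub>2
  {
    assume "((x\<^sub>1, x\<^sub>2), (y\<^sub>1, y\<^sub>2)) \<in> reg_synd_prox X d\<^sub>X f \<times> reg_synd_prox Y d\<^sub>Y g"
    then show "((x\<^sub>1, y\<^sub>1), (x\<^sub>2, y\<^sub>2)) \<in>
        reg_synd_prox (X \<times> Y) (max_dist d\<^sub>X d\<^sub>Y) (product_maps f g)"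
      using reg_synd_prox_product[OF assms(1,2)]
        uniformly_equicontinuous_generators[OF assms(2-4)] by blast
  next
    assume prox: "((x\<^sub>1, y\<^sub>1), (x\<^sub>2, y\<^sub>2)) \<in>
        reg_synd_prox (X \<times> Y) (max_dist d\<^sub>X d\<^sub>Y) (product_maps f g)"
    \<comment> \<open>The unreduced \<open>fst\<close> lets the rule unify with \<open>\<pi>\<close>
      as the projection; nonexpansiveness and semiconjugacy are left to \<open>auto\<close>.\<close>
    have "(fst (x\<^sub>1, y\<^sub>1), fst (x\<^sub>2, y\<^sub>2)) \<in> reg_synd_prox X d\<^sub>X f"
      using P.Metric_space_axioms X.Metric_space_axioms fst_cont _ _ prox
      by (rule reg_synd_prox_factor) (auto simp: max_dist_def \<omega>_product_maps)
    moreover have "(snd (x\<^sub>1, y\<^sub>1), snd (x\<^sub>2, y\<^sub>2)) \<in> reg_synd_prox Y d\<^sub>Y g"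
      using P.Metric_space_axioms Y.Metric_space_axioms snd_cont _ _ prox
      by (rule reg_synd_prox_factor) (auto simp: max_dist_def \<omega>_product_maps)
    ultimately show "((x\<^sub>1, x\<^sub>2), (y\<^sub>1, y\<^sub>2)) \<in> reg_synd_prox X d\<^sub>X f \<times> reg_synd_prox Y d\<^sub>Y g"
      by simp
  }
qed

end
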